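(* If $G$ is a (topologically) finitely generated profinite group, then the graph $\tilde\Delta(G)$ is connected.
   Context: Generation is always topological. A generating set $X$ of a profinite group $G$ is minimal if no proper subset of $X$ topologically generates $G$. The independence graph $\tilde\Gamma(G)$ is the graph whose vertices are the elements of $G$ and in which two vertices $x$ and $y$ are joined by an edge if and only if $x\neq y$ and there exists a finite minimal generating set of $G$ containing $x$ and $y$. $\tilde V(G)$ is the set of non-isolated vertices of $\tilde\Gamma(G)$ and $\tilde\Delta(G)$ is the subgraph of $\tilde\Gamma(G)$ induced by $\tilde V(G)$. A graph is connected if any two of its vertices are joined by a path (a graph with no vertices counts as connected). *)

theory Defs
  imports "HOL-Analysis.Analysis" "HOL-Algebra.Generated_Groups" "Graph_Theory.Digraph_Component"
begin

locale topological_group = group G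
  for G :: "('a, 'b) monoid_scheme" (structure) and T :: "'a topology" +
  assumes topspace_eq_carrier: "topspace T = carrier G"
    and continuous_mult: "continuous_map (prod_topology T T) T (\<lambda>(x, y). x \<otimes> y)"
    and continuous_inv: "continuous_map T T (\<lambda>x. inv x)"

definition totally_disconnected_space :: "'a topology \<Rightarrow> bool" where
  "totally_disconnected_space T \<longleftrightarrow>
     (\<forall>x \<in> topspace T. connected_component_of_set T x = {x})"

locale profinite_group = topological_group G T
  for G :: "('a, 'b) monoid_scheme" (structure) and T :: "'a topology" +
  assumes compact: "compact_space T"
    and Hausdorff: "Hausdorff_space T"
    and totally_disconnected: "totally_disconnected_space T"

definition topologically_generates ::
    "('a, 'b) monoid_scheme \<Rightarrow> 'a topology \<Rightarrow> 'a set \<Rightarrow> bool" where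
  "topologically_generates G T X \<longleftrightarrow>
     X \<subseteq> carrier G \<and> T closure_of (generate G X) = carrier G"

definition topologically_finitely_generated ::
    "('a, 'b) monoid_scheme \<Rightarrow> 'a topology \<Rightarrow> bool" where
  "topologically_finitely_generated G T \<longleftrightarrow>
     (\<exists>X. finite X \<and> topologically_generates G T X)"

definition minimal_generating_set ::
    "('a, 'b) monoid_scheme \<Rightarrow> 'a topology \<Rightarrow> 'a set \<Rightarrow> bool" where
  "minimal_generating_set G T X \<longleftrightarrow>
     topologically_generates G T X \<and> (\<forall>Y. Y \<subset> X \<longrightarrow> \<not> topologically_generates G T Y)"

text \<open>Simple graphs are loop-free symmetric digraphs without multiple arcs, an arc being the
  ordered pair of its ends.  The locale \<open>graph\<close> is not used because it demands finiteness.\<close>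

definition independence_graph ::
    "('a, 'b) monoid_scheme \<Rightarrow> 'a topology \<Rightarrow> ('a, 'a \<times> 'a) pre_digraph" where
  "independence_graph G T =
     \<lparr> verts = carrier G,
       arcs = {(x, y). x \<in> carrier G \<and> y \<in> carrier G \<and> x \<noteq> y \<and>
                 (\<exists>X. finite X \<and> minimal_generating_set G T X \<and> x \<in> X \<and> y \<in> X)},
       tail = fst, head = snd \<rparr>"

definition non_isolated_verts :: "('a, 'b) pre_digraph \<Rightarrow> 'a set" where
  "non_isolated_verts \<Gamma> = {x \<in> verts \<Gamma>. \<exists>y \<in> verts \<Gamma>. x \<rightarrow>\<^bsub>\<Gamma>\<^esub> y}"

definition reduced_independence_graph ::
    "('a, 'b) monoid_scheme \<Rightarrow> 'a topology \<Rightarrow> ('a, 'a \<times> 'a) pre_digraph" where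
  "reduced_independence_graph G T =
     independence_graph G T \<restriction> non_isolated_verts (independence_graph G T)"

text \<open>The library's \<open>connected\<close> additionally requires a nonempty vertex set; here the
  empty graph counts as connected.  For symmetric digraphs, as below, directed reachability is
  the same as being joined by a path.\<close>

definition connected_graph :: "('a, 'b) pre_digraph \<Rightarrow> bool" where
  "connected_graph \<Gamma> \<longleftrightarrow> (\<forall>x \<in> verts \<Gamma>. \<forall>y \<in> verts \<Gamma>. x \<rightarrow>\<^sup>*\<^bsub>\<Gamma>\<^esub> y)"

lemma wf_digraph_reduced_independence_graph: "wf_digraph (reduced_independence_graph G T)"
  by unfold_locales
    (auto simp: reduced_independence_graph_def)

lemma symmetric_reduced_independence_graph: "symmetric (reduced_independence_graph G T)"
  by (auto simp: symmetric_conv reduced_independence_graph_def independence_graph_def)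

end

theory Submission
  imports Defs
begin

text \<open>Suppose \<open>x\<close> and \<open>y\<close> lie in different components and in the minimal generating sets
  \<open>X\<close> and \<open>Y\<close>. Then \<open>{x, y}\<close> does not generate. The set \<open>{xy, y} \<union> (X - {x})\<close> generates, and a
  minimal generating subset of it cannot contain \<open>y\<close>: it would then avoid \<open>X - {x}\<close>, and
  \<open>{x, y}\<close> would generate. So it consists of \<open>xy\<close> and some further elements of \<open>X\<close>, which puts
  \<open>xy\<close> in the component of \<open>x\<close>. By symmetry \<open>xy\<close> lies in the component of \<open>y\<close> as well, a
  contradiction.\<close>

text \<open>Discarding elements as long as a proper subset still generates must stop, because
  \<open>X\<close> is finite.\<close>

lemma minimal_generating_subset:
  assumes "finite X" "topologically_generates G T X"
  obtains W where "W \<subseteq> X" "finite W" "minimal_generating_set G T W"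
proof -
  have "\<exists>W\<subseteq>X. minimal_generating_set G T W"
    using assms
  proof (induction X rule: finite_psubset_induct)
    case (psubset X)
    show ?case
    proof (cases "minimal_generating_set G T X")
      case False
      then obtain Y where "Y \<subset> X" "topologically_generates G T Y"
        using psubset.prems by (auto simp: minimal_generating_set_def)
      then show ?thesis
        using psubset.IH[of Y] by blast
    qed auto
  qed
  with that assms(1) show thesis
    by (meson finite_subset)
qed

lemma minimal_generating_set_eq:
  assumes "minimal_generating_set G T X" "Y \<subseteq> X" "topologically_generates G T Y"
  shows "Y = X"
  using assms unfolding minimal_generating_set_def by blast

lemma minimal_generating_set_carrier: "minimal_generating_set G T X \<Longrightarrow> X \<subseteq> carrier G"
  by (simp add: minimal_generating_set_def topologically_generates_def)

lemma independence_graph_dominates: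
  "x \<rightarrow>\<^bsub>independence_graph G T\<^esub> y \<longleftrightarrow>
    x \<noteq> y \<and> (\<exists>X. finite X \<and> minimal_generating_set G T X \<and> x \<in> X \<and> y \<in> X)"
  using minimal_generating_set_carrier
  by (simp add: arcs_ends_def arc_to_ends_def independence_graph_def) blast

text \<open>Passing to the induced subgraph loses no edge: adjacency is symmetric, so both ends of
  an edge are non-isolated.\<close>

lemma reduced_independence_graph_dominates:
  "x \<rightarrow>\<^bsub>reduced_independence_graph G T\<^esub> y \<longleftrightarrow>
    x \<noteq> y \<and> (\<exists>X. finite X \<and> minimal_generating_set G T X \<and> x \<in> X \<and> y \<in> X)"
proof -
  let ?\<Gamma> = "independence_graph G T"
  have dom: "x \<rightarrow>\<^bsub>reduced_independence_graph G T\<^esub> y \<longleftrightarrow>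
      x \<rightarrow>\<^bsub>?\<Gamma>\<^esub> y \<and> x \<in> non_isolated_verts ?\<Gamma> \<and> y \<in> non_isolated_verts ?\<Gamma>"
    unfolding reduced_independence_graph_def arcs_ends_conv by auto
  have verts: "verts ?\<Gamma> = carrier G"
    by (simp add: independence_graph_def)
  have "x \<in> non_isolated_verts ?\<Gamma> \<and> y \<in> non_isolated_verts ?\<Gamma>" if xy: "x \<rightarrow>\<^bsub>?\<Gamma>\<^esub> y"
  proof -
    have yx: "y \<rightarrow>\<^bsub>?\<Gamma>\<^esub> x"
      using xy unfolding independence_graph_dominates by metis
    have "x \<in> carrier G \<and> y \<in> carrier G"
      using xy minimal_generating_set_carrier[where G = G and T = T]
      unfolding independence_graph_dominates by (metis subsetD)
    then show ?thesis
      using xy yx unfolding non_isolated_verts_def verts by blast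
  qed
  with dom have "x \<rightarrow>\<^bsub>reduced_independence_graph G T\<^esub> y \<longleftrightarrow> x \<rightarrow>\<^bsub>?\<Gamma>\<^esub> y"
    by metis
  then show ?thesis
    by (simp only: independence_graph_dominates)
qed

lemma reachable_in_minimal_generating_set:
  assumes "finite W" "minimal_generating_set G T W" "x \<in> W" "y \<in> W" "x \<noteq> y"
  shows "x \<rightarrow>\<^sup>*\<^bsub>reduced_independence_graph G T\<^esub> y"
proof (rule wf_digraph.reachable_adjI[OF wf_digraph_reduced_independence_graph])
  show "x \<rightarrow>\<^bsub>reduced_independence_graph G T\<^esub> y"
    unfolding reduced_independence_graph_dominates using assms by blast
qed

text \<open>\<open>X \<noteq> {x}\<close> records that \<open>x\<close> is not isolated:
  \<open>X\<close> also contains a neighbour of \<open>x\<close>.\<close>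

lemma verts_reduced_independence_graphE:
  assumes "x \<in> verts (reduced_independence_graph G T)"
  obtains X where "finite X" "minimal_generating_set G T X" "x \<in> X" "X \<noteq> {x}"
  using assms
  by (auto simp: reduced_independence_graph_def non_isolated_verts_def independence_graph_dominates)

context topological_group
begin

text \<open>Inclusions of abstract subgroups pass to closures, so generating sets can be compared by
  purely algebraic computations.\<close>

lemma topologically_generates_mono:
  assumes "topologically_generates G T X" "X \<subseteq> generate G Y" "Y \<subseteq> carrier G"
  shows "topologically_generates G T Y"
proof -
  have "generate G X \<subseteq> generate G Y"
    using assms by (simp add: generate_is_subgroup generate_subgroup_incl)
  then have "carrier G \<subseteq> T closure_of generate G Y"
    using assms(1) closure_of_mono unfolding topologically_generates_def by metis
  with assms(3) show ?thesis
    unfolding topologically_generates_def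
    by (metis closure_of_subset_topspace subset_antisym topspace_eq_carrier)
qed

text \<open>The last two hypotheses let \<open>z\<close> replace \<open>x\<close> in the presence of
  \<open>y\<close>. Keeping \<open>z\<close> abstract makes both halves of the symmetric argument
  instances, with \<open>x\<close> and \<open>y\<close> interchanged.\<close>

lemma reachable_exchange:
  assumes X: "finite X" "minimal_generating_set G T X" "x \<in> X"
    and y: "y \<in> carrier G"
    and xy: "\<not> topologically_generates G T {x, y}"
    and unreachable: "\<not> x \<rightarrow>\<^sup>*\<^bsub>reduced_independence_graph G T\<^esub> y"
    and z: "z \<in> generate G {x, y}" "x \<in> generate G {z, y}"
  shows "x \<rightarrow>\<^sup>*\<^bsub>reduced_independence_graph G T\<^esub> z"
proof -
  let ?R = "reduced_independence_graph G T"
  interpret R: wf_digraph ?R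
    by (rule wf_digraph_reduced_independence_graph)
  note reachI = reachable_in_minimal_generating_set[where G = G and T = T]
  have gX: "topologically_generates G T X" and X_carrier: "X \<subseteq> carrier G"
    using X(2) by (auto simp: minimal_generating_set_def topologically_generates_def)
  then have xc: "x \<in> carrier G" and zc: "z \<in> carrier G"
    using X(3) z(1) y generate_in_carrier[of "{x, y}" z] by auto
  let ?Z = "insert z (insert y (X - {x}))"
  have "generate G {z, y} \<subseteq> generate G ?Z"
    by (rule mono_generate) auto
  then have "X \<subseteq> generate G ?Z"
    using z(2) by (auto intro: generate.incl)
  then have "topologically_generates G T ?Z"
    using topologically_generates_mono gX X_carrier y zc by auto
  then obtain W where W: "W \<subseteq> ?Z" "finite W" "minimal_generating_set G T W"
    using X(1) minimal_generating_subset by (metis finite_Diff finite_insert)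
  have gW: "topologically_generates G T W"
    using W(3) by (simp add: minimal_generating_set_def)
  \<comment> \<open>Otherwise \<open>W\<close>, and with it \<open>G\<close>, would be generated by
    \<open>{x, y}\<close>, since \<open>z\<close> is a word in \<open>x\<close> and
    \<open>y\<close>.\<close>
  have "\<not> W \<subseteq> {z, y}"
    using topologically_generates_mono[OF gW, of "{x, y}"] z(1) xc y xy
    by (auto intro: generate.incl)
  \<comment> \<open>This \<open>w\<close> is the hinge: it is adjacent to \<open>x\<close> through
    \<open>X\<close> and to every other element of \<open>W\<close> through
    \<open>W\<close>.\<close>
  then obtain w where w: "w \<in> W" "w \<in> X" "w \<noteq> x" "w \<noteq> z" "w \<noteq> y"
    using W(1) by blast
  have xw: "x \<rightarrow>\<^sup>*\<^bsub>?R\<^esub> w"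
    using X w reachI by metis
  have "y \<notin> W"
    using w W reachI xw unreachable R.reachable_trans by metis
  \<comment> \<open>By minimality of \<open>X\<close>, a generating subset of \<open>X\<close> is
    all of \<open>X\<close> and so contains \<open>x\<close>.\<close>
  moreover have "\<not> W \<subseteq> X - {x}"
    using minimal_generating_set_eq[OF X(2) _ gW] X(3) by blast
  ultimately have "z \<in> W"
    using W(1) by blast
  then show ?thesis
    using w W reachI xw R.reachable_trans by metis
qed

end

theorem theorem18:
  fixes G :: "('a, 'b) monoid_scheme" and T :: "'a topology"
  assumes "profinite_group G T"
    and "topologically_finitely_generated G T"
  shows "connected_graph (reduced_independence_graph G T)"
  unfolding connected_graph_def
proof (intro ballI, rule ccontr)
  let ?R = "reduced_independence_graph G T"
  interpret profinite_group G T
    by fact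
  interpret R: wf_digraph ?R
    by (rule wf_digraph_reduced_independence_graph)
  fix x y
  assume verts: "x \<in> verts ?R" "y \<in> verts ?R" and unreachable: "\<not> x \<rightarrow>\<^sup>*\<^bsub>?R\<^esub> y"
  note sym = symmetric_reachable[OF symmetric_reduced_independence_graph[of G T]]
  obtain X where X: "finite X" "minimal_generating_set G T X" "x \<in> X" "X \<noteq> {x}"
    using verts(1) by (rule verts_reduced_independence_graphE)
  obtain Y where Y: "finite Y" "minimal_generating_set G T Y" "y \<in> Y" "Y \<noteq> {y}"
    using verts(2) by (rule verts_reduced_independence_graphE)
  have c: "x \<in> carrier G" "y \<in> carrier G"
    using X Y by (auto simp: minimal_generating_set_def topologically_generates_def)
  have xy: "\<not> topologically_generates G T {x, y}"
  proof
    assume "topologically_generates G T {x, y}"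
    then obtain W where W: "W \<subseteq> {x, y}" "finite W" "minimal_generating_set G T W"
      using minimal_generating_subset by (metis finite.emptyI finite.insertI)
    then have "topologically_generates G T W"
      by (simp add: minimal_generating_set_def)
    \<comment> \<open>If \<open>W \<subseteq> {x}\<close>, then \<open>W \<subseteq> X\<close> and
      minimality gives \<open>X = W\<close>, so \<open>X = {x}\<close>, which was excluded; likewise
      for \<open>y\<close>.\<close>
    then have "\<not> W \<subseteq> {x}" "\<not> W \<subseteq> {y}"
      using minimal_generating_set_eq[OF X(2), of W] minimal_generating_set_eq[OF Y(2), of W] X Y
      by blast+
    then have "x \<in> W" "y \<in> W"
      using W(1) by blast+
    \<comment> \<open>Here \<open>x \<noteq> y\<close>, because a vertex reaches itself; hence
      \<open>W\<close> makes them adjacent.\<close>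
    then show False
      using W reachable_in_minimal_generating_set[of W G T x y] unreachable verts
      by auto
  qed
  have prod: "x \<otimes>\<^bsub>G\<^esub> y \<in> generate G {x, y}"
    by (simp add: generate.eng generate.incl)
  \<comment> \<open>The same product serves both orders: multiplying by an inverse on the right
    recovers \<open>x\<close>, on the left \<open>y\<close>.\<close>
  have "x = (x \<otimes>\<^bsub>G\<^esub> y) \<otimes>\<^bsub>G\<^esub> inv\<^bsub>G\<^esub> y" "y = inv\<^bsub>G\<^esub> x \<otimes>\<^bsub>G\<^esub> (x \<otimes>\<^bsub>G\<^esub> y)"
    using c by (simp_all add: m_assoc inv_solve_left)
  then have "x \<in> generate G {x \<otimes>\<^bsub>G\<^esub> y, y}" "y \<in> generate G {x \<otimes>\<^bsub>G\<^esub> y, x}"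
    by (metis generate.eng generate.incl generate.inv insertI1 insertI2)+
  moreover have "\<not> y \<rightarrow>\<^sup>*\<^bsub>?R\<^esub> x"
    using unreachable sym by blast
  ultimately have "x \<rightarrow>\<^sup>*\<^bsub>?R\<^esub> (x \<otimes>\<^bsub>G\<^esub> y)" "y \<rightarrow>\<^sup>*\<^bsub>?R\<^esub> (x \<otimes>\<^bsub>G\<^esub> y)"
    using reachable_exchange[OF X(1-3) c(2) xy unreachable prod]
      reachable_exchange[OF Y(1-3) c(1)] xy prod
    by (simp_all add: insert_commute)
  then show False
    using unreachable sym R.reachable_trans by metis
qed

end
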